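(* Let $n\in\{1,\dots,N\}$ and let $\tau_t \in \left(0,\; T_{\text{th}} - \sum_{i=1}^{n-1} \frac{l_i}{f_{\max}} - \sum_{i=n}^{N}\frac{l_i}{f_e}\right]$. Consider the optimization problem over $(f_1,\dots,f_{n-1})$: $$\min_{f_1,\dots,f_{n-1}} \; \sum_{i=1}^{n-1} k_0 f_i^2 l_i \quad \text{subject to}\quad 0\le f_i\le f_{\max}\ \ \forall i\in\{1,\dots,n-1\},\qquad \sum_{i=1}^{n-1}\frac{l_i}{f_i}\le T_{\text{th}}-\tau_t-\sum_{i=n}^{N}\frac{l_i}{f_e}.$$ Then the optimal solution of this problem is $$f_i=\frac{\sum_{j=1}^{n-1} l_j}{T_{\text{th}}-\sum_{j=n}^{N}\frac{l_j}{f_e}-\tau_t}\qquad\text{for all } i\in\{1,2,\dots,n-1\}.$$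
   Context: $N\ge 1$ is an integer (number of sub-tasks); $l_1,\dots,l_N>0$ are real numbers (workloads of the sub-tasks); $k_0>0$, $T_{\text{th}}>0$ and $f_e>f_{\max}>0$ are real constants. The convention $l_i/0=+\infty$ is used, so that a point with some $f_i=0$ violates the last constraint. For $n=1$ there are no variables and the statement is vacuous. *)

theory Defs
  imports "HOL-Library.Extended_Real"
begin

(* A point (f_1, ..., f_{n-1}) is a function nat => real of which only the
   values on {1..<n} matter. *)

definition energy :: "real \<Rightarrow> (nat \<Rightarrow> real) \<Rightarrow> nat \<Rightarrow> (nat \<Rightarrow> real) \<Rightarrow> real" where
  "energy k0 l n f = (\<Sum>i\<in>{1..<n}. k0 * (f i)\<^sup>2 * l i)"

(* The delay is summed in ereal, where l / 0 = \<infinity> for l > 0; real division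
   would give l / 0 = 0 and wrongly admit points with f_i = 0. *)

definition feasible ::
  "nat \<Rightarrow> (nat \<Rightarrow> real) \<Rightarrow> real \<Rightarrow> real \<Rightarrow> real \<Rightarrow> real \<Rightarrow> nat \<Rightarrow> (nat \<Rightarrow> real) \<Rightarrow> bool" where
  "feasible N l T_th fmax fe \<tau> n f \<longleftrightarrow>
     (\<forall>i\<in>{1..<n}. 0 \<le> f i \<and> f i \<le> fmax) \<and>
     (\<Sum>i\<in>{1..<n}. ereal (l i) / ereal (f i))
       \<le> ereal (T_th - \<tau> - (\<Sum>i\<in>{n..N}. l i / fe))"

end

theory Submission imports Defs begin

text \<open>
  Write \<open>S\<close> for the total workload, \<open>D\<close> for the remaining time and \<open>c = S / D\<close>.
  As a function of the delay \<open>1 / x\<close>, the energy \<open>x\<^sup>2\<close> is strictly convex, so for \<open>x > 0\<close> it lies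
  above its tangent \<open>3 c\<^sup>2 - 2 c\<^sup>3 / x\<close> at \<open>x = c\<close>, touching only there.
  Summing with weights \<open>l\<^sub>i\<close> and using \<open>\<Sum> l\<^sub>i / f\<^sub>i \<le> D\<close> bounds
  \<open>\<Sum> l\<^sub>i f\<^sub>i\<^sup>2\<close> below by \<open>3 c\<^sup>2 S - 2 c\<^sup>3 D = c\<^sup>2 S\<close>, with equality only
  if every \<open>f\<^sub>i\<close> equals \<open>c\<close>.
\<close>

text \<open>Multiplied by \<open>x\<close>, the difference is the cubic
  \<open>x^3 - 3 * c^2 * x + 2 * c^3\<close>. Tangency makes \<open>c\<close> a double root, and the
  cofactor \<open>x + 2 * c\<close> is positive for positive \<open>x\<close> and \<open>c\<close>,
  so the sign and the equality case can both be read off.\<close>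

lemma square_minus_tangent:
  fixes x c :: real
  assumes "x > 0"
  shows "x\<^sup>2 - (3 * c\<^sup>2 - 2 * c^3 / x) = (x - c)\<^sup>2 * (x + 2 * c) / x"
  using assms by (simp add: field_simps power2_eq_square power3_eq_cube)

lemma square_ge_tangent:
  fixes x c :: real
  assumes "x > 0" "c > 0"
  shows "3 * c\<^sup>2 - 2 * c^3 / x \<le> x\<^sup>2"
proof -
  have "0 \<le> (x - c)\<^sup>2 * (x + 2 * c) / x"
    using assms by simp
  then show ?thesis
    using square_minus_tangent[OF assms(1), of c] by linarith
qed

lemma square_eq_tangent_imp:
  fixes x c :: real
  assumes "x > 0" "c > 0" "x\<^sup>2 = 3 * c\<^sup>2 - 2 * c^3 / x"
  shows "x = c"
proof -
  have "(x - c)\<^sup>2 * (x + 2 * c) / x = 0"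
    using square_minus_tangent[of x c] assms by simp
  then show ?thesis
    using assms by simp
qed

lemma weighted_squares_bound:
  fixes l f :: "'a \<Rightarrow> real" and D :: real and A :: "'a set"
  defines "c \<equiv> sum l A / D"
  assumes "finite A" and l: "\<And>i. i \<in> A \<Longrightarrow> l i > 0" and f: "\<And>i. i \<in> A \<Longrightarrow> f i > 0"
    and "D > 0" and delay: "(\<Sum>i\<in>A. l i / f i) \<le> D"
  shows "c\<^sup>2 * sum l A \<le> (\<Sum>i\<in>A. (f i)\<^sup>2 * l i)"
    and "(\<Sum>i\<in>A. (f i)\<^sup>2 * l i) \<le> c\<^sup>2 * sum l A \<Longrightarrow> i \<in> A \<Longrightarrow> f i = c"
proof -
  let ?t = "\<lambda>i. 3 * c\<^sup>2 - 2 * c^3 / f i"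
  have c: "c > 0" if "i \<in> A" for i
  proof -
    have "sum l A > 0"
      by (rule sum_pos) (use that l \<open>finite A\<close> in auto)
    then show ?thesis
      using \<open>D > 0\<close> by (simp add: c_def)
  qed
  \<comment> \<open>For empty \<open>A\<close> the sum, and hence \<open>c\<close>, is 0, so only
    the weak inequality holds in general. It suffices for scaling the delay bound.\<close>
  have c0: "c \<ge> 0"
    using c by (cases "A = {}") (auto simp: c_def intro: less_imp_le)
  have term_le: "?t i * l i \<le> (f i)\<^sup>2 * l i" if "i \<in> A" for i
    using square_ge_tangent[OF f c] l that by (simp add: mult_right_mono)
  have "(\<Sum>i\<in>A. ?t i * l i) = 3 * c\<^sup>2 * sum l A - 2 * c^3 * (\<Sum>i\<in>A. l i / f i)"
    by (simp add: left_diff_distrib sum_subtractf sum_distrib_left)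
  moreover have "2 * c^3 * (\<Sum>i\<in>A. l i / f i) \<le> 2 * c^3 * D"
    using delay c0 by (intro mult_left_mono) auto
  moreover have "c^3 * D = c\<^sup>2 * sum l A"
    using \<open>D > 0\<close> by (simp add: c_def power2_eq_square power3_eq_cube)
  ultimately have tangent_sum: "c\<^sup>2 * sum l A \<le> (\<Sum>i\<in>A. ?t i * l i)"
    by linarith
  also have sum_le: "\<dots> \<le> (\<Sum>i\<in>A. (f i)\<^sup>2 * l i)"
    by (rule sum_mono) (rule term_le)
  finally show "c\<^sup>2 * sum l A \<le> (\<Sum>i\<in>A. (f i)\<^sup>2 * l i)" .
  \<comment> \<open>The chain of bounds now closes up: the two sums agree, so every termwise
    inequality must be an equality.\<close>
  assume "(\<Sum>i\<in>A. (f i)\<^sup>2 * l i) \<le> c\<^sup>2 * sum l A" and i: "i \<in> A"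
  with tangent_sum sum_le have "(\<Sum>i\<in>A. ?t i * l i) = (\<Sum>i\<in>A. (f i)\<^sup>2 * l i)"
    by linarith
  then have "?t i * l i = (f i)\<^sup>2 * l i"
    using term_le i \<open>finite A\<close> by (rule sum_mono_inv)
  then have "(f i)\<^sup>2 = ?t i"
    using l[OF i] by simp
  then show "f i = c"
    by (rule square_eq_tangent_imp[OF f[OF i] c[OF i]])
qed

lemma sum_ereal_delay:
  assumes "\<And>i. i \<in> A \<Longrightarrow> f i > 0"
  shows "(\<Sum>i\<in>A. ereal (l i) / ereal (f i)) = ereal (\<Sum>i\<in>A. l i / f i)"
proof -
  have "(\<Sum>i\<in>A. ereal (l i) / ereal (f i)) = (\<Sum>i\<in>A. ereal (l i / f i))"
    using assms by (intro sum.cong) (simp_all add: order_less_imp_not_eq2)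
  then show ?thesis by simp
qed

text \<open>A zero frequency has infinite delay and breaks the finite deadline. Feasible points are
  therefore strictly positive, and on those the extended-real sum is an ordinary real one.\<close>

lemma feasible_iff:
  assumes l: "\<And>i. i \<in> {1..<n} \<Longrightarrow> l i > 0"
  shows "feasible N l T_th fmax fe \<tau> n f \<longleftrightarrow>
    (\<forall>i\<in>{1..<n}. 0 < f i \<and> f i \<le> fmax) \<and>
    (\<Sum>i\<in>{1..<n}. l i / f i) \<le> T_th - \<tau> - (\<Sum>i\<in>{n..N}. l i / fe)"
proof -
  have "f i > 0" if feas: "feasible N l T_th fmax fe \<tau> n f" and i: "i \<in> {1..<n}" for i
  proof (rule ccontr)
    assume "\<not> f i > 0"
    with feas i have "f i = 0"
      unfolding feasible_def by force
    then have "ereal (l i) / ereal (f i) = \<infinity>"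
      using l[OF i] by (simp add: divide_ereal_def zero_ereal_def[symmetric])
    then have "(\<Sum>i\<in>{1..<n}. ereal (l i) / ereal (f i)) = \<infinity>"
      using i unfolding sum_Pinfty by blast
    with feas show False
      unfolding feasible_def by simp
  qed
  moreover have "feasible N l T_th fmax fe \<tau> n f \<longleftrightarrow>
      (\<forall>i\<in>{1..<n}. f i \<le> fmax) \<and>
      (\<Sum>i\<in>{1..<n}. l i / f i) \<le> T_th - \<tau> - (\<Sum>i\<in>{n..N}. l i / fe)"
    if pos: "\<And>i. i \<in> {1..<n} \<Longrightarrow> f i > 0"
  proof -
    have "(\<Sum>i\<in>{1..<n}. ereal (l i) / ereal (f i)) = ereal (\<Sum>i\<in>{1..<n}. l i / f i)"
      by (rule sum_ereal_delay) (rule pos)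
    then show ?thesis
      unfolding feasible_def using pos by (simp add: less_imp_le)
  qed
  ultimately show ?thesis
    by blast
qed

theorem theorem1:
  fixes N n :: nat and l :: "nat \<Rightarrow> real" and k0 T_th fe fmax \<tau> :: real
  assumes "N \<ge> 1"
    and "\<And>i. i \<in> {1..N} \<Longrightarrow> l i > 0"
    and "k0 > 0" and "T_th > 0"
    and "fmax > 0" and "fe > fmax"
    and "n \<in> {1..N}"
    and "\<tau> \<in> {0 <.. T_th - (\<Sum>i\<in>{1..<n}. l i / fmax) - (\<Sum>i\<in>{n..N}. l i / fe)}"
  shows "\<forall>f. is_arg_min (energy k0 l n) (feasible N l T_th fmax fe \<tau> n) f \<longleftrightarrow>
    (\<forall>i\<in>{1..<n}. f i =
       (\<Sum>j\<in>{1..<n}. l j) / (T_th - (\<Sum>j\<in>{n..N}. l j / fe) - \<tau>))"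
proof
  fix f
  let ?A = "{1..<n}"
  define S where "S = sum l ?A"
  define D where "D = T_th - (\<Sum>j\<in>{n..N}. l j / fe) - \<tau>"
  define c where "c = S / D"
  let ?P = "feasible N l T_th fmax fe \<tau> n"
  have l: "l i > 0" if "i \<in> ?A" for i
    using that assms(2,7) by auto
  have P_iff: "?P g \<longleftrightarrow> (\<forall>i\<in>?A. 0 < g i \<and> g i \<le> fmax) \<and> (\<Sum>i\<in>?A. l i / g i) \<le> D" for g
    unfolding D_def using feasible_iff[of n l N T_th fmax fe \<tau> g] l by (simp add: algebra_simps)
  have energy: "energy k0 l n g = k0 * (\<Sum>i\<in>?A. (g i)\<^sup>2 * l i)" for g
    by (simp add: energy_def sum_distrib_left mult.assoc)
  \<comment> \<open>The upper bound on \<open>\<tau>\<close> says that running every sub-task at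
    \<open>fmax\<close> meets the deadline; for nonempty \<open>?A\<close> this amounts to
    \<open>c \<le> fmax\<close>.\<close>
  have D_ge: "S / fmax \<le> D"
    using assms(8) by (simp add: S_def D_def sum_divide_distrib)
  have "S > 0" if "?A \<noteq> {}"
    unfolding S_def using that l by (intro sum_pos) auto
  with D_ge \<open>fmax > 0\<close> have D: "D > 0" if "?A \<noteq> {}"
    using that by (meson divide_pos_pos less_le_trans)
  \<comment> \<open>Values outside \<open>?A\<close> are arbitrary, so this covers every
    \<open>g\<close> that agrees with \<open>c\<close> on \<open>?A\<close>, not just the constant
    function.\<close>
  have const_P: "?P g" and const_energy: "energy k0 l n g = k0 * (c\<^sup>2 * S)"
    if g: "\<forall>i\<in>?A. g i = c" for g
  proof -
    show "?P g"
    proof (cases "?A = {}")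
      \<comment> \<open>Here \<open>n = 1\<close> and \<open>D\<close> may be 0; feasibility only
        asks for \<open>0 \<le> D\<close>.\<close>
      case True
      with D_ge show ?thesis by (simp add: P_iff S_def)
    next
      case False
      note pos = \<open>?A \<noteq> {} \<Longrightarrow> S > 0\<close>[OF False] D[OF False]
      have "0 < c" "c \<le> fmax"
        using pos D_ge \<open>fmax > 0\<close> by (simp_all add: c_def field_simps)
      moreover have "(\<Sum>i\<in>?A. l i / g i) = S / c"
        using g by (simp add: S_def sum_divide_distrib)
      moreover have "S / c = D"
        using pos by (simp add: c_def)
      ultimately show ?thesis
        using g by (simp add: P_iff)
    qed
    show "energy k0 l n g = k0 * (c\<^sup>2 * S)"
      using g by (simp add: energy S_def sum_distrib_left)
  qed
  have lower: "k0 * (c\<^sup>2 * S) \<le> energy k0 l n g" if "?P g" for g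
  proof (cases "?A = {}")
    case True
    then show ?thesis by (simp add: energy S_def)
  next
    case False
    then show ?thesis
      using weighted_squares_bound(1)[of ?A l g D] l D that \<open>k0 > 0\<close>
      by (auto simp: energy P_iff S_def c_def)
  qed
  have unique: "g i = c" if "?P g" "energy k0 l n g \<le> k0 * (c\<^sup>2 * S)" "i \<in> ?A" for g i
  proof -
    have "(\<Sum>i\<in>?A. (g i)\<^sup>2 * l i) \<le> c\<^sup>2 * S"
      using that(2) \<open>k0 > 0\<close> by (simp add: energy)
    moreover have "?A \<noteq> {}"
      using that(3) by blast
    ultimately show ?thesis
      using weighted_squares_bound(2)[of ?A l g D i] l D that(1,3) 
      by (simp add: P_iff S_def c_def)
  qed
  have "is_arg_min (energy k0 l n) ?P f \<longleftrightarrow> (\<forall>i\<in>?A. f i = c)"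
  proof
    assume f: "is_arg_min (energy k0 l n) ?P f"
    \<comment> \<open>The constant function is a feasible competitor, so a minimizer has at most its
      energy, which is what \<open>unique\<close> requires.\<close>
    have "?P (\<lambda>_. c)" "energy k0 l n (\<lambda>_. c) = k0 * (c\<^sup>2 * S)"
      by (auto intro: const_P const_energy)
    with f have "?P f" "energy k0 l n f \<le> k0 * (c\<^sup>2 * S)"
      unfolding is_arg_min_def by (auto simp: not_less)
    then show "\<forall>i\<in>?A. f i = c"
      using unique by blast
  next
    assume "\<forall>i\<in>?A. f i = c"
    then show "is_arg_min (energy k0 l n) ?P f"
      using const_P const_energy lower by (simp add: is_arg_min_def not_less)
  qed
  then show "is_arg_min (energy k0 l n) ?P f \<longleftrightarrow>
    (\<forall>i\<in>?A. f i = (\<Sum>j\<in>?A. l j) / (T_th - (\<Sum>j\<in>{n..N}. l j / fe) - \<tau>))"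
    by (simp add: c_def S_def D_def)
qed

end
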